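(* There is a constant $C$ such that for every $n\ge 2$ and any two vertices $y,z\in\{0,1,\dots,n-1\}$ the following holds: if $\pi$ is a uniformly random permutation of $\{0,1,\dots,n-1\}$, then the $d$-greedy path from $y$ to $z$ in the double cycle graph formed by $\pi$ has expected length at most $C\log n$ (that is, expected length $O(\log n)$).
   Context: Let $V=\{0,1,\dots,n-1\}$, with addition of vertices taken modulo $n$. Let $d(x,y)=(y-x) \bmod n\in\{0,\dots,n-1\}$, the graph distance in the directed cycle with edges $u\to u+1$. For a permutation $\pi$ of $V$ let $d_\pi(x,y)=d(\pi(x),\pi(y))$. The double cycle graph formed by $\pi$ is the directed graph on $V$ in which, for distinct $u,v\in V$, there is an edge from $u$ to $v$ (written $u\leadsto v$) if and only if for all $w\in V\setminus\{u,v\}$: $d(u,w)<d(u,v)\Rightarrow d_\pi(u,w)\ge d_\pi(u,v)$. (In particular each $u$ has an edge to $u+1$ and to the $v$ with $d_\pi(u,v)=1$.) The $d$-greedy path from $y$ to $z$ starts at $y$, and from each current vertex $x\ne z$ it moves along an outgoing edge of $x$ to the out-neighbor $x'$ of $x$ minimizing $d(x',z)$; it stops on reaching $z$. Its length is the number of steps. *)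

theory Defs
  imports "HOL-Probability.Probability" "HOL-Combinatorics.Permutations"
begin

definition cyc_dist :: "nat \<Rightarrow> nat \<Rightarrow> nat \<Rightarrow> nat" where
  "cyc_dist n x y = nat ((int y - int x) mod int n)"

definition perm_dist :: "nat \<Rightarrow> (nat \<Rightarrow> nat) \<Rightarrow> nat \<Rightarrow> nat \<Rightarrow> nat" where
  "perm_dist n \<pi> x y = cyc_dist n (\<pi> x) (\<pi> y)"

definition double_cycle_edge :: "nat \<Rightarrow> (nat \<Rightarrow> nat) \<Rightarrow> nat \<Rightarrow> nat \<Rightarrow> bool" where
  "double_cycle_edge n \<pi> u v \<longleftrightarrow>
     u \<in> {..<n} \<and> v \<in> {..<n} \<and> u \<noteq> v \<and>
     (\<forall>w \<in> {..<n} - {u, v}.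
        cyc_dist n u w < cyc_dist n u v \<longrightarrow> perm_dist n \<pi> u w \<ge> perm_dist n \<pi> u v)"

definition greedy_step :: "nat \<Rightarrow> (nat \<Rightarrow> nat) \<Rightarrow> nat \<Rightarrow> nat \<Rightarrow> nat \<Rightarrow> bool" where
  "greedy_step n \<pi> z x x' \<longleftrightarrow>
     is_arg_min (\<lambda>v. cyc_dist n v z) (\<lambda>v. double_cycle_edge n \<pi> x v) x'"

text \<open>A path is the list of its vertices, from the current vertex to the target \<open>z\<close>.\<close>

inductive greedy_path :: "nat \<Rightarrow> (nat \<Rightarrow> nat) \<Rightarrow> nat \<Rightarrow> nat \<Rightarrow> nat list \<Rightarrow> bool"
  for n :: nat and \<pi> :: "nat \<Rightarrow> nat" and z :: nat where
  stop: "greedy_path n \<pi> z z [z]"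
| step: "x \<noteq> z \<Longrightarrow> greedy_step n \<pi> z x x' \<Longrightarrow> greedy_path n \<pi> z x' xs
           \<Longrightarrow> greedy_path n \<pi> z x (x # xs)"

text \<open>The definite description is proper for vertices \<open>y, z < n\<close>: see
  \<open>ex1_greedy_path\<close> below. Steps are counted, so the length is one less than the
  number of vertices.\<close>

definition greedy_length :: "nat \<Rightarrow> (nat \<Rightarrow> nat) \<Rightarrow> nat \<Rightarrow> nat \<Rightarrow> nat" where
  "greedy_length n \<pi> y z = length (THE xs. greedy_path n \<pi> z y xs) - 1"

lemma int_cyc_dist: "n > 0 \<Longrightarrow> int (cyc_dist n x y) = (int y - int x) mod int n"
  by (simp add: cyc_dist_def)

lemma cyc_dist_inj_left:
  assumes "x < n" "y < n" "cyc_dist n x z = cyc_dist n y z"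
  shows "x = y"
proof -
  have "(int z - int x) mod int n = (int z - int y) mod int n"
    using assms by (metis int_cyc_dist gr_zeroI not_less_zero)
  then have "(int z - (int z - int x)) mod int n = (int z - (int z - int y)) mod int n"
    by (metis mod_diff_right_eq)
  then show ?thesis using assms by simp
qed

lemma cyc_dist_inj_right:
  assumes "x < n" "y < n" "cyc_dist n z x = cyc_dist n z y"
  shows "x = y"
proof -
  have "(int x - int z) mod int n = (int y - int z) mod int n"
    using assms by (metis int_cyc_dist gr_zeroI not_less_zero)
  then have "((int x - int z) + int z) mod int n = ((int y - int z) + int z) mod int n"
    by (metis mod_add_left_eq)
  then show ?thesis using assms by simp
qed

lemma cyc_dist_self [simp]: "cyc_dist n x x = 0"
  by (simp add: cyc_dist_def)

lemma cyc_dist_Suc: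
  assumes "x < n" "n \<ge> 2"
  shows "cyc_dist n x (Suc x mod n) = 1"
proof -
  have "(int (Suc x mod n) - int x) mod int n = (int (Suc x) - int x) mod int n"
    unfolding zmod_int by (rule mod_diff_left_eq)
  also have "\<dots> = 1" using assms by simp
  finally show ?thesis by (simp add: cyc_dist_def)
qed

lemma edge_Suc:
  assumes "x < n" "n \<ge> 2"
  shows "double_cycle_edge n \<pi> x (Suc x mod n)"
proof -
  let ?v = "Suc x mod n"
  have v: "?v < n" using assms by simp
  have neq: "x \<noteq> ?v" using cyc_dist_Suc[OF assms] by (metis cyc_dist_self zero_neq_one)
  have "w = x" if "w < n" "cyc_dist n x w < cyc_dist n x ?v" for w
    using that cyc_dist_Suc[OF assms] cyc_dist_inj_right[of w n x x] assms by auto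
  then show ?thesis using v neq assms unfolding double_cycle_edge_def by auto
qed

lemma cyc_dist_Suc_less:
  assumes "x < n" "z < n" "x \<noteq> z" "n \<ge> 2"
  shows "cyc_dist n (Suc x mod n) z < cyc_dist n x z"
proof -
  have n0: "n > 0" using assms by simp
  have pos: "cyc_dist n x z > 0"
    using cyc_dist_inj_left[of x n z z] assms by (cases "cyc_dist n x z") auto
  have lt: "int (cyc_dist n x z) < int n" using n0 by (simp add: int_cyc_dist)
  have "int (cyc_dist n (Suc x mod n) z) = (int z - int (Suc x)) mod int n"
    unfolding int_cyc_dist[OF n0] zmod_int by (rule mod_diff_right_eq)
  also have "\<dots> = ((int z - int x) - 1) mod int n" by (simp add: algebra_simps)
  also have "\<dots> = (int (cyc_dist n x z) - 1) mod int n"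
    unfolding int_cyc_dist[OF n0] by (simp add: mod_diff_left_eq)
  also have "\<dots> = int (cyc_dist n x z) - 1" using pos lt by simp
  finally show ?thesis by linarith
qed

lemma greedy_step_decreases:
  assumes "greedy_step n \<pi> z x x'" "x < n" "z < n" "x \<noteq> z" "n \<ge> 2"
  shows "x' < n" "cyc_dist n x' z < cyc_dist n x z"
proof -
  show "x' < n"
    using assms(1) by (auto simp: greedy_step_def is_arg_min_def double_cycle_edge_def)
  have "\<not> cyc_dist n (Suc x mod n) z < cyc_dist n x' z"
    using assms(1) edge_Suc[OF assms(2,5)] by (auto simp: greedy_step_def is_arg_min_def)
  then show "cyc_dist n x' z < cyc_dist n x z"
    using cyc_dist_Suc_less[of x n z] assms by simp
qed

lemma ex1_greedy_step:
  assumes "x < n" "n \<ge> 2"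
  shows "\<exists>!x'. greedy_step n \<pi> z x x'"
proof -
  obtain x' where x': "greedy_step n \<pi> z x x'"
    using ex_has_least_nat[of "double_cycle_edge n \<pi> x" "Suc x mod n" "\<lambda>v. cyc_dist n v z"]
      edge_Suc[OF assms] by (auto simp: greedy_step_def is_arg_min_linorder)
  moreover have "x'' = x'" if x'': "greedy_step n \<pi> z x x''" for x''
  proof (rule cyc_dist_inj_left)
    show "x'' < n" "x' < n"
      using x' x'' by (auto simp: greedy_step_def is_arg_min_def double_cycle_edge_def)
    show "cyc_dist n x'' z = cyc_dist n x' z"
      using x' x'' by (auto simp: greedy_step_def is_arg_min_linorder intro: antisym)
  qed
  ultimately show ?thesis by blast
qed

lemma ex1_greedy_path:
  assumes "n \<ge> 2" "y < n" "z < n"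
  shows "\<exists>!xs. greedy_path n \<pi> z y xs"
  using assms(2)
proof (induction "cyc_dist n y z" arbitrary: y rule: less_induct)
  case less
  show ?case
  proof (cases "y = z")
    case True
    then show ?thesis by (auto intro: greedy_path.stop elim: greedy_path.cases)
  next
    case False
    obtain x' where x': "greedy_step n \<pi> z y x'"
      and u: "\<And>v. greedy_step n \<pi> z y v \<Longrightarrow> v = x'"
      using ex1_greedy_step[OF less.prems assms(1)] by metis
    have "\<exists>!xs. greedy_path n \<pi> z x' xs"
      using less.hyps greedy_step_decreases[OF x' less.prems assms(3) False assms(1)] by blast
    then obtain xs where xs: "greedy_path n \<pi> z x' xs"
      and uxs: "\<And>ys. greedy_path n \<pi> z x' ys \<Longrightarrow> ys = xs" by metis
    show ?thesis
    proof (rule ex1I)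
      show "greedy_path n \<pi> z y (y # xs)" by (rule greedy_path.step[OF False x' xs])
    next
      fix ys assume "greedy_path n \<pi> z y ys"
      then show "ys = y # xs" using False u uxs by (cases rule: greedy_path.cases) auto
    qed
  qed
qed

end

theory Submission
  imports Defs "HOL-Analysis.Harmonic_Numbers"
begin

text \<open>
  The length of a greedy path is a number of records of a random sequence, and records of a
  random sequence are logarithmically rare.

  The out-neighbours of \<open>x\<close> on the arc from \<open>x\<close> to \<open>z\<close> are the successive minima of
  \<open>d\<^sub>\<pi>(x, \<cdot>)\<close> as one walks along the arc, so the one closest to \<open>z\<close> is the minimizer of
  \<open>d\<^sub>\<pi>(x, \<cdot>)\<close> over the whole arc (\<open>greedy_step_perm_dist_less\<close>). As long as every vertex
  ahead of \<open>x\<close> is farther from \<open>y\<close> in the second cycle than \<open>x\<close> is, the distances to such vertices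
  from \<open>y\<close> exceed those from \<open>x\<close> by a constant, and so every step of the path minimizes the same
  function \<open>d\<^sub>\<pi>(y, \<cdot>)\<close> over the vertices still ahead. After \<open>y\<close>, the path therefore visits
  precisely those vertices of the arc from \<open>y\<close> to \<open>z\<close> at which \<open>d\<^sub>\<pi>(y, \<cdot>)\<close> is smaller than at all
  later vertices of the arc (\<open>greedy_length_eq_card_suffix_minima\<close>).

  If \<open>j\<close> is the distance from a vertex \<open>w\<close> to \<open>z\<close>, this asks \<open>w\<close> to be the best of \<open>j + 1\<close>
  vertices. They are exchangeable under a uniformly random permutation, so the probability is
  \<open>1 / (j + 1)\<close> (\<open>prob_strict_min_perm_dist\<close>). Hence the expected length is exactly the harmonic
  number of \<open>d(y, z)\<close> (\<open>expectation_greedy_length\<close>).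
\<close>

section \<open>Distances in a directed cycle\<close>

lemma cyc_dist_less: "n > 0 \<Longrightarrow> cyc_dist n x y < n"
  using int_cyc_dist[of n x y] by (metis of_nat_0_less_iff of_nat_less_iff pos_mod_bound)

lemma cyc_dist_via_target:
  assumes "n > 0"
  shows "int (cyc_dist n x w) = (int (cyc_dist n x z) - int (cyc_dist n w z)) mod int n"
proof -
  have "(int (cyc_dist n x z) - int (cyc_dist n w z)) mod int n
      = ((int z - int x) - (int z - int w)) mod int n"
    unfolding int_cyc_dist[OF assms] by (rule mod_diff_eq)
  then show ?thesis by (simp add: int_cyc_dist[OF assms])
qed

lemma cyc_dist_via_source:
  assumes "n > 0"
  shows "int (cyc_dist n x w) = (int (cyc_dist n y w) - int (cyc_dist n y x)) mod int n"
proof -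
  have "(int (cyc_dist n y w) - int (cyc_dist n y x)) mod int n
      = ((int w - int y) - (int x - int y)) mod int n"
    unfolding int_cyc_dist[OF assms] by (rule mod_diff_eq)
  then show ?thesis by (simp add: int_cyc_dist[OF assms])
qed

lemma cyc_dist_add_target:
  assumes "n > 0" "cyc_dist n w z \<le> cyc_dist n x z"
  shows "cyc_dist n x w + cyc_dist n w z = cyc_dist n x z"
  using cyc_dist_via_target[OF assms(1), of x w z] assms cyc_dist_less[OF assms(1), of x z]
  by simp

lemma cyc_dist_add_source:
  assumes "n > 0" "cyc_dist n y x \<le> cyc_dist n y w"
  shows "cyc_dist n y x + cyc_dist n x w = cyc_dist n y w"
  using cyc_dist_via_source[OF assms(1), of x w y] assms cyc_dist_less[OF assms(1), of y w]
  by simp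

text \<open>A vertex beyond \<open>z\<close>, as seen from \<open>x\<close>, is reached only after all vertices up to \<open>z\<close>; it
  thus never competes with them in the edge condition at \<open>x\<close>.\<close>

lemma cyc_dist_less_imp_on_arc:
  assumes "n > 0" "cyc_dist n v z \<le> cyc_dist n x z" "cyc_dist n x w < cyc_dist n x v"
  shows "cyc_dist n w z \<le> cyc_dist n x z"
proof (rule ccontr)
  assume beyond: "\<not> ?thesis"
  have "int (cyc_dist n x w)
      = (int (cyc_dist n x z) - int (cyc_dist n w z) + int n) mod int n"
    using cyc_dist_via_target[OF assms(1), of x w z] by simp
  also have "\<dots> = int (cyc_dist n x z) - int (cyc_dist n w z) + int n"
    using beyond cyc_dist_less[OF assms(1), of w z] by (intro mod_pos_pos_trivial) auto
  finally show False
    using assms(3) cyc_dist_add_target[OF assms(1,2)] cyc_dist_less[OF assms(1), of w z] by simp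
qed

lemma bij_betw_cyc_dist:
  assumes "z < n"
  shows "bij_betw (\<lambda>w. cyc_dist n w z) {..<n} {..<n}"
proof -
  have inj: "inj_on (\<lambda>w. cyc_dist n w z) {..<n}"
    by (auto intro!: inj_onI cyc_dist_inj_left[of _ n _ z])
  have "(\<lambda>w. cyc_dist n w z) ` {..<n} \<subseteq> {..<n}"
    using assms cyc_dist_less[of n] by auto
  then show ?thesis
    using inj endo_inj_surj[of "{..<n}"] by (auto simp: bij_betw_def)
qed

lemma bij_betw_cyc_dist_less:
  assumes "z < n" "k \<le> n"
  shows "bij_betw (\<lambda>w. cyc_dist n w z) {w \<in> {..<n}. cyc_dist n w z < k} {..<k}"
proof -
  have "(\<lambda>w. cyc_dist n w z) ` {w \<in> {..<n}. cyc_dist n w z < k}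
      = (\<lambda>w. cyc_dist n w z) ` {..<n} \<inter> {..<k}" by auto
  also have "\<dots> = {..<k}"
    using bij_betw_cyc_dist[OF assms(1)] assms(2) by (auto simp: bij_betw_def)
  finally show ?thesis
    using bij_betw_cyc_dist[OF assms(1)] by (auto simp: bij_betw_def inj_on_def)
qed

lemma perm_dist_inj_right:
  assumes "\<pi> permutes {..<n}" "y < n" "v < n" "w < n" "perm_dist n \<pi> y v = perm_dist n \<pi> y w"
  shows "v = w"
proof -
  have "\<pi> v < n" "\<pi> w < n"
    using permutes_in_image[OF assms(1)] assms by auto
  then have "\<pi> v = \<pi> w"
    using assms(5) cyc_dist_inj_right[of "\<pi> v" n "\<pi> w" "\<pi> y"] by (simp add: perm_dist_def)
  then show ?thesis using permutes_inj[OF assms(1)] by (simp add: inj_eq)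
qed

lemma perm_dist_add:
  "n > 0 \<Longrightarrow> perm_dist n \<pi> y x \<le> perm_dist n \<pi> y w
    \<Longrightarrow> perm_dist n \<pi> y x + perm_dist n \<pi> x w = perm_dist n \<pi> y w"
  unfolding perm_dist_def by (rule cyc_dist_add_source)

section \<open>Greedy paths are sequences of suffix minima\<close>

text \<open>The minimizer \<open>m\<close> of \<open>d\<^sub>\<pi>(x, \<cdot>)\<close> on the arc ahead of \<open>x\<close> is an out-neighbour of \<open>x\<close>. An
  out-neighbour even closer to \<open>z\<close> would have \<open>m\<close> before it on the arc, so the edge condition
  would make it at least as good as \<open>m\<close>.\<close>

lemma greedy_step_perm_dist_less:
  assumes perm: "\<pi> permutes {..<n}" and n: "n \<ge> 2" and x: "x < n" and z: "z < n" "x \<noteq> z"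
    and st: "greedy_step n \<pi> z x x'"
    and w: "w < n" "cyc_dist n w z < cyc_dist n x z" "w \<noteq> x'"
  shows "perm_dist n \<pi> x x' < perm_dist n \<pi> x w"
proof -
  have n0: "n > 0" using n by simp
  have x': "x' < n" "cyc_dist n x' z < cyc_dist n x z"
    using greedy_step_decreases[OF st x z n] by auto
  have edge: "double_cycle_edge n \<pi> x x'"
    and closest: "\<And>v. double_cycle_edge n \<pi> x v \<Longrightarrow> cyc_dist n x' z \<le> cyc_dist n v z"
    using st by (auto simp: greedy_step_def is_arg_min_linorder)
  obtain m where m: "m < n" "cyc_dist n m z < cyc_dist n x z"
    and mmin: "\<And>v. v < n \<Longrightarrow> cyc_dist n v z < cyc_dist n x z
                 \<Longrightarrow> perm_dist n \<pi> x m \<le> perm_dist n \<pi> x v"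
    using ex_has_least_nat[of "\<lambda>v. v < n \<and> cyc_dist n v z < cyc_dist n x z" w "perm_dist n \<pi> x"] w
    by blast
  have "double_cycle_edge n \<pi> x m"
    unfolding double_cycle_edge_def
  proof (intro conjI ballI impI)
    show "x \<noteq> m" using m(2) by auto
    fix v assume v: "v \<in> {..<n} - {x, m}" "cyc_dist n x v < cyc_dist n x m"
    have "cyc_dist n v z \<le> cyc_dist n x z"
      using cyc_dist_less_imp_on_arc[OF n0 _ v(2), of z] m(2) by simp
    moreover have "cyc_dist n v z \<noteq> cyc_dist n x z"
      using v(1) x cyc_dist_inj_left[of v n x z] by auto
    ultimately show "perm_dist n \<pi> x m \<le> perm_dist n \<pi> x v"
      using mmin v(1) by auto
  qed (use m x in auto)
  then have le: "cyc_dist n x' z \<le> cyc_dist n m z" by (rule closest)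
  have "x' = m"
  proof (rule ccontr)
    assume neq: "x' \<noteq> m"
    then have "cyc_dist n x' z < cyc_dist n m z"
      using le cyc_dist_inj_left[of x' n m z] x' m by (metis le_neq_implies_less)
    then have "cyc_dist n x m < cyc_dist n x x'"
      using cyc_dist_add_target[OF n0, of m z x] cyc_dist_add_target[OF n0, of x' z x] m(2) x'(2)
      by linarith
    then have "perm_dist n \<pi> x x' \<le> perm_dist n \<pi> x m"
      using edge neq m by (auto simp: double_cycle_edge_def)
    with mmin[OF x'] have "perm_dist n \<pi> x x' = perm_dist n \<pi> x m" by simp
    with neq show False using perm_dist_inj_right[OF perm x] x' m by blast
  qed
  moreover have "perm_dist n \<pi> x m \<noteq> perm_dist n \<pi> x w"
    using perm_dist_inj_right[OF perm x m(1) w(1)] w(3) \<open>x' = m\<close> by auto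
  ultimately show ?thesis using mmin[OF w(1,2)] by simp
qed

definition suffix_minimum :: "nat \<Rightarrow> nat \<Rightarrow> (nat \<Rightarrow> nat) \<Rightarrow> nat \<Rightarrow> bool" where
  "suffix_minimum n z f w \<longleftrightarrow>
     (\<forall>w' \<in> {..<n}. cyc_dist n w' z < cyc_dist n w z \<longrightarrow> f w < f w')"

text \<open>The invariant that the current vertex \<open>x\<close> is itself a suffix minimum of \<open>d\<^sub>\<pi>(y, \<cdot>)\<close> allows
  every step to be measured from \<open>y\<close> instead of from \<open>x\<close>: it excludes a wrap-around of the second
  cycle past \<open>y\<close>. The next vertex is then the first suffix minimum ahead of \<open>x\<close>.\<close>

lemma greedy_path_length:
  assumes perm: "\<pi> permutes {..<n}" and n: "n \<ge> 2" and z: "z < n"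
    and path: "greedy_path n \<pi> z x xs" and x: "x < n"
    and min: "suffix_minimum n z (perm_dist n \<pi> y) x"
  shows "length xs = Suc (card {w \<in> {..<n}. cyc_dist n w z < cyc_dist n x z
                            \<and> suffix_minimum n z (perm_dist n \<pi> y) w})"
  using path x min
proof (induction rule: greedy_path.induct)
  case stop
  show ?case by simp
next
  case (step x x' xs)
  let ?f = "perm_dist n \<pi> y"
  let ?S = "\<lambda>x. {w \<in> {..<n}. cyc_dist n w z < cyc_dist n x z \<and> suffix_minimum n z ?f w}"
  have n0: "n > 0" using n by simp
  have x': "x' < n" "cyc_dist n x' z < cyc_dist n x z"
    using greedy_step_decreases[OF step.hyps(2) step.prems(1) z step.hyps(1) n] by auto
  have f_add: "?f v = ?f x + perm_dist n \<pi> x v"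
    if "v < n" "cyc_dist n v z < cyc_dist n x z" for v
  proof -
    have "?f x < ?f v" using step.prems(2) that by (auto simp: suffix_minimum_def)
    then show ?thesis using perm_dist_add[OF n0, of \<pi> y x v] by simp
  qed
  have less: "?f x' < ?f w" if "w < n" "cyc_dist n w z < cyc_dist n x z" "w \<noteq> x'" for w
    using greedy_step_perm_dist_less[OF perm n step.prems(1) z step.hyps(1,2) that]
      f_add[OF that(1,2)] f_add[OF x'] by simp
  have min': "suffix_minimum n z ?f x'"
    unfolding suffix_minimum_def using less x' by fastforce
  have "?S x = insert x' (?S x')"
  proof (intro equalityI subsetI)
    fix w assume w: "w \<in> ?S x"
    show "w \<in> insert x' (?S x')"
    proof (cases "w = x'")
      case False
      then have "?f x' < ?f w" using less w by simp
      then have "\<not> cyc_dist n x' z < cyc_dist n w z"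
        using w x' by (force simp: suffix_minimum_def)
      moreover have "cyc_dist n x' z \<noteq> cyc_dist n w z"
        using False w x' cyc_dist_inj_left[of w n x' z] by auto
      ultimately show ?thesis using w by auto
    qed simp
  qed (use x' min' in auto)
  moreover have "x' \<notin> ?S x'" "finite (?S x')" by auto
  ultimately show ?case using step.IH[OF x'(1) min'] by simp
qed

lemma greedy_length_eq_card_suffix_minima:
  assumes perm: "\<pi> permutes {..<n}" and n: "n \<ge> 2" and y: "y < n" and z: "z < n"
  shows "greedy_length n \<pi> y z = card {w \<in> {..<n}. cyc_dist n w z < cyc_dist n y z
                            \<and> suffix_minimum n z (perm_dist n \<pi> y) w}"
proof -
  have path: "greedy_path n \<pi> z y (THE xs. greedy_path n \<pi> z y xs)"
    by (rule theI'[OF ex1_greedy_path[OF n y z]])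
  have "suffix_minimum n z (perm_dist n \<pi> y) y"
    unfolding suffix_minimum_def
  proof (intro ballI impI)
    fix w assume w: "w \<in> {..<n}" "cyc_dist n w z < cyc_dist n y z"
    have "perm_dist n \<pi> y y = 0" by (simp add: perm_dist_def)
    moreover have "perm_dist n \<pi> y y \<noteq> perm_dist n \<pi> y w"
      using perm_dist_inj_right[OF perm y y, of w] w by auto
    ultimately show "perm_dist n \<pi> y y < perm_dist n \<pi> y w" by simp
  qed
  from greedy_path_length[OF perm n z path y this] show ?thesis
    by (simp add: greedy_length_def)
qed

section \<open>The expected number of suffix minima\<close>

text \<open>Composing a permutation with the transposition of two elements of \<open>W\<close> exchanges their roles
  and fixes \<open>y\<close>. Thus the permutations are split evenly according to which element of \<open>W\<close> is the
  unique minimizer.\<close>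

lemma prob_strict_min_perm_dist:
  assumes y: "y < n" and W: "W \<subseteq> {..<n}" "y \<notin> W" and w: "w \<in> W"
  shows "measure_pmf.prob (pmf_of_set {\<pi>. \<pi> permutes {..<n}})
           {\<pi>. \<forall>u \<in> W - {w}. perm_dist n \<pi> y w < perm_dist n \<pi> y u} = 1 / real (card W)"
proof -
  define P where "P = {\<pi>. \<pi> permutes {..<n}}"
  define E where "E v = {\<pi> \<in> P. \<forall>u \<in> W - {v}. perm_dist n \<pi> y v < perm_dist n \<pi> y u}" for v
  have finP: "finite P" and P_ne: "P \<noteq> {}"
    unfolding P_def using permutes_id[of "{..<n}"] finite_permutations[of "{..<n}"] by blast+
  have finW: "finite W" using W(1) finite_subset by blast
  have swap: "\<pi> \<circ> Transposition.transpose v v' \<in> E v'"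
    if v: "v \<in> W" "v' \<in> W" and \<pi>: "\<pi> \<in> E v" for v v' \<pi>
  proof -
    have "Transposition.transpose v v' permutes {..<n}"
      using v W(1) by (intro permutes_swap_id) auto
    then have "\<pi> \<circ> Transposition.transpose v v' \<in> P"
      using \<pi> permutes_compose by (auto simp: E_def P_def)
    moreover have "Transposition.transpose v v' y = y"
      using v W(2) by (intro transpose_apply_other) auto
    then have "perm_dist n (\<pi> \<circ> Transposition.transpose v v') y u
        = perm_dist n \<pi> y (Transposition.transpose v v' u)" for u
      by (simp add: perm_dist_def)
    moreover have "Transposition.transpose v v' u \<in> W - {v}" if "u \<in> W - {v'}" for u
      using that v by (auto simp: Transposition.transpose_def)
    ultimately show ?thesis using \<pi> by (auto simp: E_def)
  qed
  have card_E: "card (E v) = card (E w)" if v: "v \<in> W" for v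
  proof (rule bij_betw_same_card)
    show "bij_betw (\<lambda>\<pi>. \<pi> \<circ> Transposition.transpose v w) (E v) (E w)"
      using swap[OF v w] swap[OF w v]
      by (intro bij_betw_byWitness[where f' = "\<lambda>\<pi>. \<pi> \<circ> Transposition.transpose v w"])
         (auto simp: comp_assoc transpose_commute)
  qed
  have "P = (\<Union>v\<in>W. E v)"
  proof (intro equalityI subsetI)
    fix \<pi> assume \<pi>: "\<pi> \<in> P"
    obtain v where v: "v \<in> W" "\<And>u. u \<in> W \<Longrightarrow> perm_dist n \<pi> y v \<le> perm_dist n \<pi> y u"
      using ex_has_least_nat[of "\<lambda>v. v \<in> W" w "perm_dist n \<pi> y"] w by blast
    have "perm_dist n \<pi> y v < perm_dist n \<pi> y u" if u: "u \<in> W - {v}" for u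
      using v(2)[of u] perm_dist_inj_right[of \<pi> n y v u] u v(1) \<pi> y W(1)
      by (auto simp: P_def order_le_less)
    then show "\<pi> \<in> (\<Union>v\<in>W. E v)" using v(1) \<pi> by (auto simp: E_def)
  qed (auto simp: E_def)
  moreover have "card (\<Union>v\<in>W. E v) = (\<Sum>v\<in>W. card (E v))"
  proof (rule card_UN_disjoint[OF finW])
    show "\<forall>v\<in>W. finite (E v)" using finP by (auto simp: E_def)
    show "\<forall>v\<in>W. \<forall>v'\<in>W. v \<noteq> v' \<longrightarrow> E v \<inter> E v' = {}"
    proof (intro ballI impI equals0I)
      fix v v' \<pi> assume v: "v \<in> W" "v' \<in> W" "v \<noteq> v'" and \<pi>: "\<pi> \<in> E v \<inter> E v'"
      have "perm_dist n \<pi> y v < perm_dist n \<pi> y v'" "perm_dist n \<pi> y v' < perm_dist n \<pi> y v"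
        using v \<pi> by (auto simp: E_def)
      then show False by simp
    qed
  qed
  ultimately have card_P: "card P = card W * card (E w)"
    using card_E by simp
  have "card P > 0" using finP P_ne by (simp add: card_gt_0_iff)
  have "measure_pmf.prob (pmf_of_set P)
          {\<pi>. \<forall>u \<in> W - {w}. perm_dist n \<pi> y w < perm_dist n \<pi> y u} = card (E w) / card P"
    unfolding E_def by (subst measure_pmf_of_set[OF P_ne finP]) (simp add: Int_def)
  also have "\<dots> = 1 / real (card W)"
    using card_P \<open>card P > 0\<close> by (auto simp: field_simps)
  finally show ?thesis by (simp add: P_def)
qed

lemma prob_suffix_minimum:
  assumes y: "y < n" and z: "z < n" and w: "w < n" "cyc_dist n w z < cyc_dist n y z"
  shows "measure_pmf.prob (pmf_of_set {\<pi>. \<pi> permutes {..<n}})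
           {\<pi>. suffix_minimum n z (perm_dist n \<pi> y) w} = 1 / real (Suc (cyc_dist n w z))"
proof -
  let ?W = "{v \<in> {..<n}. cyc_dist n v z < Suc (cyc_dist n w z)}"
  have "cyc_dist n w z < n" using cyc_dist_less[of n w z] z by simp
  then have card_W: "card ?W = Suc (cyc_dist n w z)"
    using bij_betw_same_card[OF bij_betw_cyc_dist_less[OF z, of "Suc (cyc_dist n w z)"]] by simp
  have "?W - {w} = {v \<in> {..<n}. cyc_dist n v z < cyc_dist n w z}"
    using w(1) cyc_dist_inj_left[of _ n w z] by (auto simp: less_Suc_eq)
  then have "suffix_minimum n z f w \<longleftrightarrow> (\<forall>u \<in> ?W - {w}. f w < f u)" for f
    by (auto simp: suffix_minimum_def)
  moreover have "?W \<subseteq> {..<n}" "y \<notin> ?W" "w \<in> ?W" using w by auto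
  ultimately show ?thesis
    using prob_strict_min_perm_dist[OF y, of ?W w] card_W by simp
qed

lemma expectation_greedy_length:
  assumes n: "n \<ge> 2" and y: "y < n" and z: "z < n"
  shows "measure_pmf.expectation (pmf_of_set {\<pi>. \<pi> permutes {..<n}})
           (\<lambda>\<pi>. real (greedy_length n \<pi> y z)) = harm (cyc_dist n y z)"
proof -
  define P where "P = {\<pi> :: nat \<Rightarrow> nat. \<pi> permutes {..<n}}"
  define A where "A = {w \<in> {..<n}. cyc_dist n w z < cyc_dist n y z}"
  define R where "R w = {\<pi>. suffix_minimum n z (perm_dist n \<pi> y) w}" for w
  have finP: "finite P" and P_ne: "P \<noteq> {}"
    unfolding P_def using permutes_id[of "{..<n}"] finite_permutations[of "{..<n}"] by blast+
  have finA: "finite A" by (simp add: A_def)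
  have length: "real (greedy_length n \<pi> y z) = (\<Sum>w\<in>A. indicat_real (R w) \<pi>)" if "\<pi> \<in> P" for \<pi>
  proof -
    have "greedy_length n \<pi> y z = card {w \<in> A. \<pi> \<in> R w}"
      using greedy_length_eq_card_suffix_minima[of \<pi> n y z] that n y z
      by (simp add: P_def A_def R_def conj_assoc)
    moreover have "(\<Sum>w\<in>A. indicat_real (R w) \<pi>) = real (card {w \<in> A. \<pi> \<in> R w})"
      using finA by (simp add: indicator_def sum.If_cases Int_def)
    ultimately show ?thesis by simp
  qed
  have "measure_pmf.expectation (pmf_of_set P) (\<lambda>\<pi>. real (greedy_length n \<pi> y z))
      = measure_pmf.expectation (pmf_of_set P) (\<lambda>\<pi>. \<Sum>w\<in>A. indicat_real (R w) \<pi>)"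
    by (rule integral_cong_AE) (use length finP P_ne in \<open>auto simp: AE_measure_pmf_iff\<close>)
  also have "\<dots> = (\<Sum>w\<in>A. measure_pmf.prob (pmf_of_set P) (R w))"
    using finP P_ne by (subst Bochner_Integration.integral_sum)
      (simp_all add: integrable_measure_pmf_finite)
  also have "\<dots> = (\<Sum>w\<in>A. 1 / real (Suc (cyc_dist n w z)))"
    using prob_suffix_minimum[OF y z] by (intro sum.cong) (auto simp: P_def A_def R_def)
  also have "\<dots> = (\<Sum>j<cyc_dist n y z. 1 / real (Suc j))"
    unfolding A_def using cyc_dist_less[of n y z] z
    by (intro sum.reindex_bij_betw[OF bij_betw_cyc_dist_less[OF z]]) simp
  also have "\<dots> = harm (cyc_dist n y z)"
    unfolding harm_def by (rule sum.reindex_bij_witness[of _ "\<lambda>k. k - 1" Suc]) (auto simp: field_simps)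
  finally show ?thesis by (simp add: P_def)
qed

theorem theorem5p4:
  shows "\<exists>C :: real. \<forall>n :: nat. n \<ge> 2 \<longrightarrow> (\<forall>y \<in> {..<n}. \<forall>z \<in> {..<n}.
           measure_pmf.expectation (pmf_of_set {\<pi> :: nat \<Rightarrow> nat. \<pi> permutes {..<n}})
             (\<lambda>\<pi>. real (greedy_length n \<pi> y z)) \<le> C * ln (real n))"
proof (intro exI[of _ 3] allI impI ballI)
  fix n y z :: nat assume n: "n \<ge> 2" and y: "y \<in> {..<n}" and z: "z \<in> {..<n}"
  have "harm (cyc_dist n y z) \<le> (harm n :: real)"
    using cyc_dist_less[of n y z] n by (intro harm_mono) simp
  also have "\<dots> \<le> 1 + ln (real n)"
    using euler_mascheroni_sequence_decreasing[of 1 n] n by (simp add: harm_expand)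
  (* The summand 1 is absorbed because ln n \<ge> ln 2 \<ge> 1/2. *)
  also have "\<dots> \<le> 3 * ln (real n)"
  proof -
    have "1 / 2 \<le> ln (2 :: real)" using ln2_ge_two_thirds by simp
    also have "\<dots> \<le> ln (real n)" using n by simp
    finally show ?thesis by simp
  qed
  finally show "measure_pmf.expectation (pmf_of_set {\<pi> :: nat \<Rightarrow> nat. \<pi> permutes {..<n}})
             (\<lambda>\<pi>. real (greedy_length n \<pi> y z)) \<le> 3 * ln (real n)"
    using expectation_greedy_length[of n y z] n y z by simp
qed

end
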